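(* Let $P\in\mathsf{cpGCL}^{\boxtimes}$ with program variables $x_1,\dots,x_n$, let $P'$ be obtained from $P$ by the observation-flagging transformation with a fresh Boolean variable $rerun$, and let $P''$ be the observation-free program $$s_1,\dots,s_n:=x_1,\dots,x_n;\ rerun:=\mathtt{true};\ \mathtt{while}(rerun)\{\,x_1,\dots,x_n:=s_1,\dots,s_n;\ rerun:=\mathtt{false};\ P'\,\}$$ where $s_1,\dots,s_n$ are fresh variables. Then for every expectation $f$ with values in $[0,\infty]$ (depending only on the variables of $P$), $$\underline{\mathsf{cwp}}[P](f)=\mathsf{wp}[P''](f),$$ at every initial state where the quotient $\underline{\mathsf{cwp}}[P](f)$ is defined.
   Context: **Programs.** $\mathbb S$ is the set of program states (valuations of program variables). $\mathsf{cpGCL}^{\boxtimes}$ is the set of programs generated by $$P::=\mathtt{skip}\mid\mathtt{abort}\mid x:=E\mid \mathtt{observe}\,G\mid P;P\mid \mathtt{ite}(G)\{P\}\{P\}\mid\{P\}[p]\{P\}\mid\mathtt{while}(G)\{P\},$$ with $x$ a variable, $E$ an arithmetic expression, $G$ a Boolean expression over the variables, $p\in[0,1]$. **Transformation $P\mapsto P'$.** With a fresh Boolean variable $rerun$, $P'$ is obtained from $P$ by recursively replacing (in all subprograms, including loop bodies) $\mathtt{observe}\,G$ by $\mathtt{ite}(\neg G)\{rerun:=\mathtt{true}\}\{\mathtt{skip}\}$; $\mathtt{abort}$ by $\mathtt{ite}(\neg rerun)\{\mathtt{abort}\}\{\mathtt{skip}\}$; and $\mathtt{while}(G)\{Q\}$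 by $\mathtt{while}(G\wedge\neg rerun)\{Q'\}$; all other constructs are unchanged apart from applying the rules to their subprograms. The multiple assignments in $P''$ copy the variables simultaneously. States of $P''$ are valuations of all variables $x_i,s_i,rerun$; $f$ and $\underline{\mathsf{cwp}}[P](f)$ are regarded as functions of such states through the values of $x_1,\dots,x_n$. **Expectations.** $\mathbb E=\{f:\mathbb S\to[0,\infty]\}$, $\mathbb E_{\le1}=\{g:\mathbb S\to[0,1]\}$, ordered pointwise by $\sqsubseteq$. $\mathbf 0,\mathbf 1$ are constant functions; $\chi_G$ is the indicator of $G$; $f[x/E](\sigma)=f(\sigma[x\leftarrow E(\sigma)])$; arithmetic is pointwise with $0\cdot\infty=0$. **wp.** $\mathsf{wp}[P]:\mathbb E\to\mathbb E$ for observation-free programs: $\mathsf{wp}[\mathtt{skip}](f)=f$; $\mathsf{wp}[\mathtt{abort}](f)=\mathbf0$; $\mathsf{wp}[x:=E](f)=f[x/E]$; $\mathsf{wp}[P_1;P_2]=\mathsf{wp}[P_1]\circ\mathsf{wp}[P_2]$; $\mathsf{wp}[\mathtt{ite}(G)\{P_1\}\{P_2\}](f)=\chi_G\cdot\mathsf{wp}[P_1](f)+\chi_{\neg G}\cdot\mathsf{wp}[P_2](f)$; $\mathsf{wp}[\{P_1\}[p]\{P_2\}](f)=p\cdot\mathsf{wp}[P_1](f)+(1-p)\cdot\mathsf{wp}[P_2](f)$; $\mathsf{wp}[\mathtt{while}(G)\{P'\}](f)$ is the least fixed point of $\hat f\mapsto\chi_G\cdot\mathsf{wp}[P'](\hat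 f)+\chi_{\neg G}\cdot f$ in $(\mathbb E,\sqsubseteq)$. **cwp.** $\mathsf{cwp}[P]:\mathbb E\times\mathbb E_{\le1}\to\mathbb E\times\mathbb E_{\le1}$ (sums and scalar multiples componentwise): $\mathsf{cwp}[\mathtt{skip}](f,g)=(f,g)$; $\mathsf{cwp}[\mathtt{abort}](f,g)=(\mathbf0,\mathbf1)$; $\mathsf{cwp}[x:=E](f,g)=(f[x/E],g[x/E])$; $\mathsf{cwp}[\mathtt{observe}\,G](f,g)=\chi_G\cdot(f,g)$; $\mathsf{cwp}[P_1;P_2]=\mathsf{cwp}[P_1]\circ\mathsf{cwp}[P_2]$; $\mathsf{cwp}[\mathtt{ite}(G)\{P_1\}\{P_2\}](f,g)=\chi_G\cdot\mathsf{cwp}[P_1](f,g)+\chi_{\neg G}\cdot\mathsf{cwp}[P_2](f,g)$; $\mathsf{cwp}[\{P_1\}[p]\{P_2\}](f,g)=p\cdot\mathsf{cwp}[P_1](f,g)+(1-p)\cdot\mathsf{cwp}[P_2](f,g)$; $\mathsf{cwp}[\mathtt{while}(G)\{P'\}](f,g)$ is the least fixed point w.r.t. $(\sqsubseteq,\sqsupseteq)$ of $(\hat f,\hat g)\mapsto\chi_G\cdot\mathsf{cwp}[P'](\hat f,\hat g)+\chi_{\neg G}\cdot(f,g)$. With $\mathsf{cwp}_i$ the $i$-th component, $\underline{\mathsf{cwp}}[P](f)=\mathsf{cwp}_1[P](f,\mathbf1)/\mathsf{cwp}_2[P](f,\mathbf1)$, defined at the states where the denominator is nonzero. *)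

theory Defs
  imports "HOL-Library.Extended_Nonnegative_Real" "HOL-Library.Indicator_Function"
begin

section \<open>States, expressions and expectations\<close>

text \<open>Besides values from an arbitrary (numeric) domain \<open>'a\<close>, variables can hold truth values,
  since \<open>rerun\<close> is a Boolean program variable. Expressions and guards are represented by the
  functions on states that they denote; occurrence of variables in them is replaced by
  \<open>depends_only\<close>.\<close>

datatype 'a val = Num 'a | Bool bool

type_synonym ('v, 'a) state = "'v \<Rightarrow> 'a val"
type_synonym ('v, 'a) expr = "('v, 'a) state \<Rightarrow> 'a val"
type_synonym ('v, 'a) guard = "('v, 'a) state \<Rightarrow> bool"
type_synonym ('v, 'a) expectation = "('v, 'a) state \<Rightarrow> ennreal"

definition depends_only :: "'v set \<Rightarrow> (('v, 'a) state \<Rightarrow> 'b) \<Rightarrow> bool" where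
  "depends_only V h \<longleftrightarrow> (\<forall>\<sigma> \<tau>. (\<forall>x\<in>V. \<sigma> x = \<tau> x) \<longrightarrow> h \<sigma> = h \<tau>)"

abbreviation chi :: "('v, 'a) guard \<Rightarrow> ('v, 'a) expectation" where
  "chi G \<equiv> indicator {\<sigma>. G \<sigma>}"

definition upd_list :: "('v, 'a) state \<Rightarrow> 'v list \<Rightarrow> 'a val list \<Rightarrow> ('v, 'a) state" where
  "upd_list \<sigma> xs vs = (\<lambda>y. case map_of (zip xs vs) y of None \<Rightarrow> \<sigma> y | Some v \<Rightarrow> v)"

section \<open>Programs with observations\<close>

text \<open>\<open>PChoice P p Q\<close> runs \<open>P\<close> with probability \<open>p\<close>.\<close>

datatype ('v, 'a) cpgcl =
    Skip
  | Abort
  | Assign 'v "('v, 'a) expr"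
  | Observe "('v, 'a) guard"
  | Seq "('v, 'a) cpgcl" "('v, 'a) cpgcl"
  | Ite "('v, 'a) guard" "('v, 'a) cpgcl" "('v, 'a) cpgcl"
  | PChoice "('v, 'a) cpgcl" real "('v, 'a) cpgcl"
  | While "('v, 'a) guard" "('v, 'a) cpgcl"

text \<open>Programs all of whose variables are in \<open>V\<close> and whose branching probabilities are
  in \<open>[0,1]\<close>.\<close>

primrec cpgcl_over :: "'v set \<Rightarrow> ('v, 'a) cpgcl \<Rightarrow> bool" where
  "cpgcl_over V Skip \<longleftrightarrow> True"
| "cpgcl_over V Abort \<longleftrightarrow> True"
| "cpgcl_over V (Assign x E) \<longleftrightarrow> x \<in> V \<and> depends_only V E"
| "cpgcl_over V (Observe G) \<longleftrightarrow> depends_only V G"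
| "cpgcl_over V (Seq P Q) \<longleftrightarrow> cpgcl_over V P \<and> cpgcl_over V Q"
| "cpgcl_over V (Ite G P Q) \<longleftrightarrow> depends_only V G \<and> cpgcl_over V P \<and> cpgcl_over V Q"
| "cpgcl_over V (PChoice P p Q) \<longleftrightarrow> 0 \<le> p \<and> p \<le> 1 \<and> cpgcl_over V P \<and> cpgcl_over V Q"
| "cpgcl_over V (While G P) \<longleftrightarrow> depends_only V G \<and> cpgcl_over V P"

section \<open>Conditional weakest preexpectations\<close>

type_synonym ('v, 'a) expectation2 = "('v, 'a) expectation \<times> ('v, 'a) expectation"

definition scale2 :: "('v, 'a) expectation \<Rightarrow> ('v, 'a) expectation2 \<Rightarrow> ('v, 'a) expectation2" where
  "scale2 h X = (\<lambda>\<sigma>. h \<sigma> * fst X \<sigma>, \<lambda>\<sigma>. h \<sigma> * snd X \<sigma>)"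

definition add2 :: "('v, 'a) expectation2 \<Rightarrow> ('v, 'a) expectation2 \<Rightarrow> ('v, 'a) expectation2" where
  "add2 X Y = (\<lambda>\<sigma>. fst X \<sigma> + fst Y \<sigma>, \<lambda>\<sigma>. snd X \<sigma> + snd Y \<sigma>)"

definition expectations2 :: "('v, 'a) expectation2 set" where
  "expectations2 = {X. \<forall>\<sigma>. snd X \<sigma> \<le> 1}"

definition le2 :: "('v, 'a) expectation2 \<Rightarrow> ('v, 'a) expectation2 \<Rightarrow> bool" where
  "le2 X Y \<longleftrightarrow> fst X \<le> fst Y \<and> snd Y \<le> snd X"

text \<open>The bound in \<open>expectations2\<close> matters: with a second component ranging over all of
  \<open>[0,\<infinity>]\<close>, a loop that never terminates would get \<open>\<infinity>\<close> there instead of \<open>1\<close>.\<close>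

definition lfp2 ::
  "(('v, 'a) expectation2 \<Rightarrow> ('v, 'a) expectation2) \<Rightarrow> ('v, 'a) expectation2" where
  "lfp2 F = (THE X. X \<in> expectations2 \<and> F X = X \<and>
                    (\<forall>Y\<in>expectations2. F Y = Y \<longrightarrow> le2 X Y))"

primrec cwp :: "('v, 'a) cpgcl \<Rightarrow> ('v, 'a) expectation2 \<Rightarrow> ('v, 'a) expectation2" where
  "cwp Skip X = X"
| "cwp Abort X = (\<lambda>_. 0, \<lambda>_. 1)"
| "cwp (Assign x E) X = (\<lambda>\<sigma>. fst X (\<sigma>(x := E \<sigma>)), \<lambda>\<sigma>. snd X (\<sigma>(x := E \<sigma>)))"
| "cwp (Observe G) X = scale2 (chi G) X"
| "cwp (Seq P Q) X = cwp P (cwp Q X)"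
| "cwp (Ite G P Q) X =
     add2 (scale2 (chi G) (cwp P X)) (scale2 (chi (\<lambda>\<sigma>. \<not> G \<sigma>)) (cwp Q X))"
| "cwp (PChoice P p Q) X =
     add2 (scale2 (\<lambda>_. ennreal p) (cwp P X)) (scale2 (\<lambda>_. ennreal (1 - p)) (cwp Q X))"
| "cwp (While G P) X =
     lfp2 (\<lambda>Y. add2 (scale2 (chi G) (cwp P Y)) (scale2 (chi (\<lambda>\<sigma>. \<not> G \<sigma>)) X))"

definition cwp1 :: "('v, 'a) cpgcl \<Rightarrow> ('v, 'a) expectation \<Rightarrow> ('v, 'a) expectation" where
  "cwp1 P f = fst (cwp P (f, \<lambda>_. 1))"

definition cwp2 :: "('v, 'a) cpgcl \<Rightarrow> ('v, 'a) expectation \<Rightarrow> ('v, 'a) expectation" where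
  "cwp2 P f = snd (cwp P (f, \<lambda>_. 1))"

text \<open>Only meaningful at states \<open>\<sigma>\<close> with \<open>cwp2 P f \<sigma> \<noteq> 0\<close>.\<close>

definition cwp_cond :: "('v, 'a) cpgcl \<Rightarrow> ('v, 'a) expectation \<Rightarrow> ('v, 'a) expectation" where
  "cwp_cond P f \<sigma> = cwp1 P f \<sigma> / cwp2 P f \<sigma>"

section \<open>Observation-free programs and weakest preexpectations\<close>

text \<open>\<open>PMAssign\<close> is the simultaneous assignment to a list of distinct variables.\<close>

datatype ('v, 'a) pgcl =
    PSkip
  | PAbort
  | PAssign 'v "('v, 'a) expr"
  | PMAssign "'v list" "('v, 'a) expr list"
  | PSeq "('v, 'a) pgcl" "('v, 'a) pgcl"
  | PIte "('v, 'a) guard" "('v, 'a) pgcl" "('v, 'a) pgcl"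
  | PPChoice "('v, 'a) pgcl" real "('v, 'a) pgcl"
  | PWhile "('v, 'a) guard" "('v, 'a) pgcl"

primrec wp :: "('v, 'a) pgcl \<Rightarrow> ('v, 'a) expectation \<Rightarrow> ('v, 'a) expectation" where
  "wp PSkip f = f"
| "wp PAbort f = (\<lambda>_. 0)"
| "wp (PAssign x E) f = (\<lambda>\<sigma>. f (\<sigma>(x := E \<sigma>)))"
| "wp (PMAssign xs Es) f = (\<lambda>\<sigma>. f (upd_list \<sigma> xs (map (\<lambda>E. E \<sigma>) Es)))"
| "wp (PSeq P Q) f = wp P (wp Q f)"
| "wp (PIte G P Q) f = (\<lambda>\<sigma>. chi G \<sigma> * wp P f \<sigma> + chi (\<lambda>\<sigma>. \<not> G \<sigma>) \<sigma> * wp Q f \<sigma>)"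
| "wp (PPChoice P p Q) f = (\<lambda>\<sigma>. ennreal p * wp P f \<sigma> + ennreal (1 - p) * wp Q f \<sigma>)"
| "wp (PWhile G P) f = lfp (\<lambda>h \<sigma>. chi G \<sigma> * wp P h \<sigma> + chi (\<lambda>\<sigma>. \<not> G \<sigma>) \<sigma> * f \<sigma>)"

section \<open>Replacing observations by a rerun loop\<close>

abbreviation var_true :: "'v \<Rightarrow> ('v, 'a) guard" where
  "var_true r \<equiv> \<lambda>\<sigma>. \<sigma> r = Bool True"

primrec flag_obs :: "'v \<Rightarrow> ('v, 'a) cpgcl \<Rightarrow> ('v, 'a) pgcl" where
  "flag_obs r Skip = PSkip"
| "flag_obs r Abort = PIte (\<lambda>\<sigma>. \<not> var_true r \<sigma>) PAbort PSkip"
| "flag_obs r (Assign x E) = PAssign x E"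
| "flag_obs r (Observe G) = PIte (\<lambda>\<sigma>. \<not> G \<sigma>) (PAssign r (\<lambda>_. Bool True)) PSkip"
| "flag_obs r (Seq P Q) = PSeq (flag_obs r P) (flag_obs r Q)"
| "flag_obs r (Ite G P Q) = PIte G (flag_obs r P) (flag_obs r Q)"
| "flag_obs r (PChoice P p Q) = PPChoice (flag_obs r P) p (flag_obs r Q)"
| "flag_obs r (While G P) = PWhile (\<lambda>\<sigma>. G \<sigma> \<and> \<not> var_true r \<sigma>) (flag_obs r P)"

definition copy_vars :: "'v list \<Rightarrow> 'v list \<Rightarrow> ('v, 'a) pgcl" where
  "copy_vars ys xs = PMAssign ys (map (\<lambda>x \<sigma>. \<sigma> x) xs)"

definition rerun_prog ::
  "'v list \<Rightarrow> 'v list \<Rightarrow> 'v \<Rightarrow> ('v, 'a) cpgcl \<Rightarrow> ('v, 'a) pgcl" where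
  "rerun_prog xs ss r P =
     PSeq (copy_vars ss xs)
       (PSeq (PAssign r (\<lambda>_. Bool True))
         (PWhile (var_true r)
           (PSeq (copy_vars xs ss)
             (PSeq (PAssign r (\<lambda>_. Bool False)) (flag_obs r P)))))"

end

theory Submission
  imports Defs
begin

text \<open>Let \<open>a\<close> be the expected reward of the runs of \<open>P\<close> violating no observation and \<open>q\<close> the
  probability of a violation, so that \<open>cwp1 = a\<close> and \<open>cwp2 = 1 - q\<close>. As \<open>P'\<close> surely terminates
  once the flag is set, the value \<open>c\<close> of the rerun loop satisfies \<open>c = a + c * q\<close>. Hence
  \<open>c = a / (1 - q)\<close> if \<open>c\<close> is finite and \<open>q < 1\<close>. Conversely \<open>a / (1 - q)\<close> gives a prefixed
  point of the loop functional, so that \<open>c \<le> a / (1 - q)\<close>, which settles \<open>c = \<infinity>\<close>.\<close>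

section \<open>Continuity of branching; monotonicity and unfolding of \<open>wp\<close>\<close>

lemma sup_continuous_ite_step:
  fixes F :: "'c::complete_lattice \<Rightarrow> ('v, 'a) expectation"
  assumes "sup_continuous F" "sup_continuous H"
  shows "sup_continuous (\<lambda>h \<sigma>. if G \<sigma> then F h \<sigma> else H h \<sigma>)"
  by (intro order_continuous_intros assms[THEN sup_continuous_applyD])

lemma sup_continuous_choice_step:
  fixes F :: "'c::complete_lattice \<Rightarrow> ('v, 'a) expectation"
  assumes "sup_continuous F" "sup_continuous H"
  shows "sup_continuous (\<lambda>h \<sigma>. p * F h \<sigma> + q * H h \<sigma>)"
  by (intro order_continuous_intros assms[THEN sup_continuous_applyD])

lemma chi_ite: "chi G \<sigma> * a + chi (\<lambda>\<sigma>. \<not> G \<sigma>) \<sigma> * b = (if G \<sigma> then a else (b::ennreal))"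
  by simp

lemma wp_mono:
  assumes "f \<le> g"
  shows "wp P f \<le> wp P g"
  using assms
proof (induction P arbitrary: f g)
  case (PIte G P Q)
  then have "wp P f \<le> wp P g" "wp Q f \<le> wp Q g" by blast+
  then show ?case by (simp add: chi_ite le_fun_def)
next
  case (PPChoice P p Q)
  then have "wp P f \<le> wp P g" "wp Q f \<le> wp Q g" by blast+
  then show ?case by (simp add: le_fun_def add_mono mult_left_mono)
next
  case (PWhile G P)
  show ?case
    unfolding wp.simps chi_ite
    using PWhile.prems by (intro lfp_mono) (simp add: le_fun_def)
qed (auto simp: le_fun_def)

lemma mono_loop_step:
  "mono (\<lambda>h \<sigma>. if G \<sigma> then wp P h \<sigma> else f \<sigma>)"
  by (rule monoI, rule le_funI) (simp add: wp_mono[THEN le_funD])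

lemma wp_While_unfold:
  "wp (PWhile G P) f = (\<lambda>\<sigma>. if G \<sigma> then wp P (wp (PWhile G P) f) \<sigma> else f \<sigma>)"
  using lfp_unfold[OF mono_loop_step[of G P f]] by (simp only: wp.simps chi_ite)

lemma wp_While_le:
  assumes "\<And>\<sigma>. (if G \<sigma> then wp P h \<sigma> else f \<sigma>) \<le> h \<sigma>"
  shows "wp (PWhile G P) f \<le> h"
  unfolding wp.simps chi_ite using assms by (intro lfp_lowerbound le_funI)

text \<open>Expected reward of \<open>P\<close> if a run that violates an observation stops at once with
  reward \<open>c\<close> and other terminating runs are rewarded by \<open>h\<close>. For \<open>c = 0\<close> this is the first
  component of \<open>cwp\<close>; for \<open>c = 1\<close> it is the complement of the second one, which turns the
  greatest fixed point there into a least one.\<close>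

primrec owp :: "ennreal \<Rightarrow> ('v, 'a) cpgcl \<Rightarrow> ('v, 'a) expectation \<Rightarrow> ('v, 'a) expectation"
  where
  "owp c Skip h = h"
| "owp c Abort h = (\<lambda>_. 0)"
| "owp c (Assign x E) h = (\<lambda>\<sigma>. h (\<sigma>(x := E \<sigma>)))"
| "owp c (Observe G) h = (\<lambda>\<sigma>. if G \<sigma> then h \<sigma> else c)"
| "owp c (Seq P Q) h = owp c P (owp c Q h)"
| "owp c (Ite G P Q) h = (\<lambda>\<sigma>. if G \<sigma> then owp c P h \<sigma> else owp c Q h \<sigma>)"
| "owp c (PChoice P p Q) h = (\<lambda>\<sigma>. ennreal p * owp c P h \<sigma> + ennreal (1 - p) * owp c Q h \<sigma>)"
| "owp c (While G P) h = lfp (\<lambda>k \<sigma>. if G \<sigma> then owp c P k \<sigma> else h \<sigma>)"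

section \<open>Continuity, boundedness and locality of \<open>owp\<close>\<close>

text \<open>Continuity turns each loop of \<open>owp\<close> into the supremum of its finite
  iterates from \<open>bot\<close>; locality and the lower bound for flagged loops rest on
  this.\<close>

lemma sup_continuous_owp: "sup_continuous (owp c P)"
proof (induction P)
  case (Assign x E)
  show ?case unfolding owp.simps[abs_def] by (intro order_continuous_intros)
next
  case (Seq P Q)
  then show ?case unfolding owp.simps[abs_def] by (rule sup_continuous_compose)
next
  case (Ite G P Q)
  then show ?case unfolding owp.simps[abs_def] by (rule sup_continuous_ite_step)
next
  case (PChoice P p Q)
  then show ?case unfolding owp.simps[abs_def] by (rule sup_continuous_choice_step)
next
  case (While G P)
  show ?case
    unfolding owp.simps[abs_def]
    by (intro sup_continuous_lfp'' sup_continuous_ite_step While sup_continuous_const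
        sup_continuous_id sup_continuous_compose[OF While])
qed (auto simp: owp.simps[abs_def] intro!: order_continuous_intros)

lemma sup_continuous_owp_loop_step:
  "sup_continuous (\<lambda>k \<sigma>. if G \<sigma> then owp c P k \<sigma> else h \<sigma>)"
  by (intro sup_continuous_ite_step sup_continuous_owp sup_continuous_const)

text \<open>In a loop the constant 1 is a prefixed point. The bound makes complements to 1 lossless,
  although \<open>ennreal\<close> subtraction is truncated.\<close>

lemma owp_le_1:
  assumes "c \<le> 1" "cpgcl_over V P" "\<And>\<sigma>. h \<sigma> \<le> 1"
  shows "owp c P h \<sigma> \<le> 1"
  using assms(2,3)
proof (induction P arbitrary: h \<sigma>)
  case (PChoice P p Q)
  have "ennreal p * owp c P h \<sigma> + ennreal (1 - p) * owp c Q h \<sigma>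
      \<le> ennreal p * 1 + ennreal (1 - p) * 1"
    using PChoice by (intro add_mono mult_left_mono) auto
  also have "\<dots> = 1"
    using PChoice.prems(1) by (simp flip: ennreal_plus)
  finally show ?case by simp
next
  case (While G P)
  have "lfp (\<lambda>k \<sigma>. if G \<sigma> then owp c P k \<sigma> else h \<sigma>) \<le> (\<lambda>_. 1)"
    using While by (intro lfp_lowerbound le_funI) auto
  then show ?case by (simp add: le_fun_def)
qed (use assms(1) in auto)

lemma depends_onlyI:
  assumes "\<And>\<sigma> \<tau>. \<forall>x\<in>V. \<sigma> x = \<tau> x \<Longrightarrow> h \<sigma> = h \<tau>"
  shows "depends_only V h"
  using assms unfolding depends_only_def by blast

lemma depends_onlyD:
  assumes "depends_only V h" "\<forall>x\<in>V. \<sigma> x = \<tau> x"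
  shows "h \<sigma> = h \<tau>"
  using assms unfolding depends_only_def by blast

lemma depends_only_if:
  assumes "depends_only V G" "depends_only V h" "depends_only V k"
  shows "depends_only V (\<lambda>\<sigma>. if G \<sigma> then h \<sigma> else k \<sigma>)"
proof (rule depends_onlyI)
  fix \<sigma> \<tau> :: "('a, 'b) state"
  assume "\<forall>x\<in>V. \<sigma> x = \<tau> x"
  note eqs = assms[THEN depends_onlyD, OF this]
  show "(if G \<sigma> then h \<sigma> else k \<sigma>) = (if G \<tau> then h \<tau> else k \<tau>)"
    by (simp only: eqs)
qed

text \<open>For the final comparison: the restored state and the initial one are only known to agree
  on the program variables.\<close>

lemma depends_only_owp:
  assumes "cpgcl_over V P" "depends_only V h"
  shows "depends_only V (owp c P h)"
  using assms
proof (induction P arbitrary: h)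
  case (Assign x E)
  show ?case
  proof (rule depends_onlyI)
    fix \<sigma> \<tau> :: "('a, 'b) state"
    assume eq: "\<forall>y\<in>V. \<sigma> y = \<tau> y"
    then have "E \<sigma> = E \<tau>"
      using Assign.prems(1) by (intro depends_onlyD[of V E]) simp_all
    with eq have "h (\<sigma>(x := E \<sigma>)) = h (\<tau>(x := E \<tau>))"
      by (intro depends_onlyD[OF Assign.prems(2)]) simp
    then show "owp c (Assign x E) h \<sigma> = owp c (Assign x E) h \<tau>"
      by simp
  qed
next
  case (Observe G)
  have "depends_only V (\<lambda>_. c)"
    by (rule depends_onlyI) simp
  with Observe show ?case
    unfolding owp.simps by (intro depends_only_if) simp_all
next
  case (Ite G P Q)
  then show ?case by (simp add: depends_only_if)
next
  case (PChoice P p Q)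
  then have PQ: "depends_only V (owp c P h)" "depends_only V (owp c Q h)" by simp_all
  show ?case
  proof (rule depends_onlyI)
    fix \<sigma> \<tau> :: "('a, 'b) state"
    assume "\<forall>x\<in>V. \<sigma> x = \<tau> x"
    note eqs = PQ[THEN depends_onlyD, OF this]
    show "owp c (PChoice P p Q) h \<sigma> = owp c (PChoice P p Q) h \<tau>"
      by (simp only: owp.simps eqs)
  qed
next
  case (While G P)
  let ?F = "\<lambda>k \<sigma>. if G \<sigma> then owp c P k \<sigma> else h \<sigma>"
  have iter: "depends_only V ((?F ^^ n) bot)" for n
  proof (induction n)
    case 0
    show ?case by (rule depends_onlyI) simp
  next
    case (Suc n)
    have "depends_only V (owp c P ((?F ^^ n) bot))"
      by (rule While.IH[OF _ Suc]) (use While.prems in simp)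
    then have "depends_only V (?F ((?F ^^ n) bot))"
      using While.prems by (intro depends_only_if) simp_all
    then show ?case by (simp only: funpow.simps o_apply)
  qed
  have "depends_only V (SUP n. (?F ^^ n) bot)"
  proof (rule depends_onlyI)
    fix \<sigma> \<tau> :: "('a, 'b) state"
    assume "\<forall>x\<in>V. \<sigma> x = \<tau> x"
    note eqs = iter[THEN depends_onlyD, OF this]
    show "(SUP n. (?F ^^ n) bot) \<sigma> = (SUP n. (?F ^^ n) bot) \<tau>"
      unfolding SUP_apply eqs ..
  qed
  then show ?case
    by (simp only: owp.simps sup_continuous_lfp[OF sup_continuous_owp_loop_step])
qed (auto intro: depends_onlyI)

section \<open>Expressing \<open>cwp\<close> by \<open>owp\<close>\<close>

lemma lfp2_eqI:
  assumes "X \<in> expectations2" "F X = X"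
    and "\<And>Y. Y \<in> expectations2 \<Longrightarrow> F Y = Y \<Longrightarrow> le2 X Y"
  shows "lfp2 F = X"
  unfolding lfp2_def
proof (rule the_equality)
  fix Z assume Z: "Z \<in> expectations2 \<and> F Z = Z \<and> (\<forall>Y\<in>expectations2. F Y = Y \<longrightarrow> le2 Z Y)"
  with assms have "le2 Z X" "le2 X Z" by auto
  then show "Z = X" by (auto simp: le2_def intro!: prod_eqI)
qed (use assms in auto)

lemma ennreal_le_1_cases:
  fixes a :: ennreal
  assumes "a \<le> 1"
  obtains x where "a = ennreal x" "0 \<le> x" "x \<le> 1"
  using assms by (cases a) (auto simp: top_unique)

lemma one_minus_ennreal: "1 - ennreal x = ennreal (1 - x)" if "0 \<le> x"
  using that ennreal_minus[of x 1] by simp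

lemma ennreal_one_minus_minus: "1 - (1 - a) = a" if "a \<le> 1" for a :: ennreal
  using that by (elim ennreal_le_1_cases) (simp add: one_minus_ennreal)

text \<open>The weights sum to 1; the bounds allow passing to reals, where subtraction is
  linear.\<close>

lemma ennreal_one_minus_convex:
  fixes a b :: ennreal
  assumes "0 \<le> p" "p \<le> 1" "a \<le> 1" "b \<le> 1"
  shows "ennreal p * (1 - a) + ennreal (1 - p) * (1 - b) =
    1 - (ennreal p * a + ennreal (1 - p) * b)"
proof -
  obtain x y where xy: "a = ennreal x" "b = ennreal y" "0 \<le> x" "x \<le> 1" "0 \<le> y" "y \<le> 1"
    using assms(3,4) by (elim ennreal_le_1_cases)
  have "ennreal p * (1 - a) + ennreal (1 - p) * (1 - b) = ennreal (p * (1 - x) + (1 - p) * (1 - y))"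
    using xy assms(1,2) by (simp add: one_minus_ennreal ennreal_mult)
  also have "p * (1 - x) + (1 - p) * (1 - y) = 1 - (p * x + (1 - p) * y)"
    by (simp add: algebra_simps)
  also have "ennreal \<dots> = 1 - ennreal (p * x + (1 - p) * y)"
    using xy assms(1,2)
    by (simp only: one_minus_ennreal add_nonneg_nonneg mult_nonneg_nonneg diff_ge_0_iff_ge)
  also have "\<dots> = 1 - (ennreal p * a + ennreal (1 - p) * b)"
    using xy assms(1,2) by (simp add: ennreal_mult)
  finally show ?thesis .
qed

text \<open>Complementing the second component reverses its order, so the mixed fixed point splits
  into two ordinary least ones. A general complement \<open>1 - v\<close> is carried so that
  sequences can be composed.\<close>

lemma cwp_eq_owp:
  assumes "cpgcl_over V P" "\<And>\<sigma>. v \<sigma> \<le> 1"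
  shows "cwp P (f, \<lambda>\<sigma>. 1 - v \<sigma>) = (owp 0 P f, \<lambda>\<sigma>. 1 - owp 1 P v \<sigma>)"
  using assms
proof (induction P arbitrary: f v)
  case (Seq P Q)
  then show ?case using owp_le_1[of 1 V Q v] by simp
next
  case (Ite G P Q)
  then show ?case by (simp add: add2_def scale2_def chi_ite if_distrib)
next
  case (PChoice P p Q)
  have le: "owp 1 P v \<sigma> \<le> 1" "owp 1 Q v \<sigma> \<le> 1" for \<sigma>
    using PChoice.prems owp_le_1[of 1 V _ v] by auto
  show ?case
    using PChoice by (simp add: add2_def scale2_def ennreal_one_minus_convex[OF _ _ le])
next
  case (While G P)
  let ?F = "\<lambda>Y. add2 (scale2 (chi G) (cwp P Y))
    (scale2 (chi (\<lambda>\<sigma>. \<not> G \<sigma>)) (f, \<lambda>\<sigma>. 1 - v \<sigma>))"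
  let ?A = "\<lambda>k \<sigma>. if G \<sigma> then owp 0 P k \<sigma> else f \<sigma>"
  let ?D = "\<lambda>k \<sigma>. if G \<sigma> then owp 1 P k \<sigma> else v \<sigma>"
  have F: "?F (a, \<lambda>\<sigma>. 1 - d \<sigma>) = (?A a, \<lambda>\<sigma>. 1 - ?D d \<sigma>)" if "\<And>\<sigma>. d \<sigma> \<le> 1" for a d
    using While that by (simp add: add2_def scale2_def chi_ite if_distrib)
  have A: "lfp ?A = ?A (lfp ?A)" and D: "lfp ?D = ?D (lfp ?D)"
    by (rule lfp_unfold sup_continuous_mono sup_continuous_owp_loop_step)+
  have D_apply: "lfp ?D \<sigma> = (if G \<sigma> then owp 1 P (lfp ?D) \<sigma> else v \<sigma>)" for \<sigma>
    using fun_cong[OF D] .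
  have D1: "lfp ?D \<sigma> \<le> 1" for \<sigma>
    using owp_le_1[of 1 V "While G P" v \<sigma>] While.prems by simp
  have "lfp2 ?F = (lfp ?A, \<lambda>\<sigma>. 1 - lfp ?D \<sigma>)"
  proof (rule lfp2_eqI)
    show "?F (lfp ?A, \<lambda>\<sigma>. 1 - lfp ?D \<sigma>) = (lfp ?A, \<lambda>\<sigma>. 1 - lfp ?D \<sigma>)"
      by (simp only: F[OF D1] A[symmetric] D_apply[symmetric])
  next
    fix Y :: "('a, 'b) expectation2"
    assume Y: "Y \<in> expectations2" "?F Y = Y"
    obtain a b where ab: "Y = (a, b)" by (cases Y)
    \<comment> \<open>Complementing again recovers \<open>b\<close> only because
      \<open>expectations2\<close> bounds it by 1.\<close>
    define d where "d = (\<lambda>\<sigma>. 1 - b \<sigma>)"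
    have d1: "d \<sigma> \<le> 1" for \<sigma>
      by (simp add: d_def diff_le_self_ennreal)
    have b: "b = (\<lambda>\<sigma>. 1 - d \<sigma>)"
      using Y(1) by (auto simp: d_def ab expectations2_def ennreal_one_minus_minus)
    have fix_a: "?A a = a" and fix_b: "(\<lambda>\<sigma>. 1 - ?D d \<sigma>) = (\<lambda>\<sigma>. 1 - d \<sigma>)"
      using Y(2) F[OF d1, of a] unfolding ab b by auto
    \<comment> \<open>With both \<open>?D d\<close> and \<open>d\<close> at most 1, the truncated
      subtraction in \<open>fix_b\<close> can be cancelled.\<close>
    have "?D d \<sigma> \<le> 1" for \<sigma>
      using owp_le_1[of 1 V P d \<sigma>] While.prems d1 by auto
    then have "?D d \<sigma> = d \<sigma>" for \<sigma>
      using fun_cong[OF fix_b, of \<sigma>] d1[of \<sigma>] ennreal_one_minus_minus by metis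
    then have fix_d: "?D d = d" ..
    have "lfp ?A \<le> a" "lfp ?D \<le> d"
      by (rule lfp_lowerbound, simp only: fix_a fix_d order.refl)+
    then show "le2 (lfp ?A, \<lambda>\<sigma>. 1 - lfp ?D \<sigma>) Y"
      by (auto simp: le2_def ab b le_fun_def intro: ennreal_minus_mono)
  qed (auto simp: expectations2_def diff_le_self_ennreal)
  then show ?case by simp
qed (auto simp: scale2_def)

corollary cwp12_eq_owp:
  assumes "cpgcl_over V P"
  shows "cwp1 P f = owp 0 P f" "cwp2 P f = (\<lambda>\<sigma>. 1 - owp 1 P (\<lambda>_. 0) \<sigma>)"
  using cwp_eq_owp[OF assms, of "\<lambda>_. 0" f] by (simp_all add: cwp1_def cwp2_def)

text \<open>\<open>C\<close> is the value of restarting, which may depend on the saved variables only.\<close>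

definition restart :: "'v \<Rightarrow> ('v, 'a) expectation \<Rightarrow> ('v, 'a) expectation \<Rightarrow>
    ('v, 'a) expectation \<Rightarrow> ('v, 'a) expectation" where
  "restart r C f v = (\<lambda>\<sigma>. if \<sigma> r = Bool True then C \<sigma> else f \<sigma> + C \<sigma> * v \<sigma>)"

section \<open>Value of the flagged program\<close>

lemma restart_SUP_le:
  assumes "incseq a" "incseq d" "\<And>n. restart r C (a n) (d n) \<le> h"
  shows "restart r C (SUP n. a n) (SUP n. d n) \<le> h"
proof (rule le_funI)
  fix \<sigma>
  have "restart r C (SUP n. a n) (SUP n. d n) \<sigma> =
      (SUP n. restart r C (a n) (d n) \<sigma>)"
  proof (cases "\<sigma> r = Bool True")
    case False
    have "(SUP n. a n \<sigma> + C \<sigma> * d n \<sigma>) = (SUP n. a n \<sigma>) + (SUP n. C \<sigma> * d n \<sigma>)"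
      using assms(1,2)
      by (intro ennreal_SUP_add) (auto simp: mono_def le_fun_def intro!: mult_left_mono)
    with False show ?thesis
      by (simp add: restart_def SUP_mult_left_ennreal image_comp)
  qed (simp add: restart_def)
  also have "\<dots> \<le> h \<sigma>"
    using assms(3) by (intro SUP_least) (simp add: le_fun_def)
  finally show "restart r C (SUP n. a n) (SUP n. d n) \<sigma> \<le> h \<sigma>" .
qed

text \<open>Once the flag is set, loops exit, \<open>Abort\<close> acts as \<open>Skip\<close> and
  assignments preserve \<open>C\<close>, so the remaining program returns \<open>C\<close>.
  Otherwise a violation sets the flag and contributes \<open>C\<close> weighted by its probability,
  so the value is affine in \<open>C\<close>.\<close>

lemma wp_flag_obs_restart:
  assumes "cpgcl_over V P" "r \<notin> V"
    and C: "\<And>\<sigma> x w. x \<in> insert r V \<Longrightarrow> C (\<sigma>(x := w)) = C \<sigma>"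
  shows "wp (flag_obs r P) (restart r C f v) = restart r C (owp 0 P f) (owp 1 P v)"
  using assms(1)
proof (induction P arbitrary: f v)
  case (Assign x E)
  then show ?case
    using assms(2) by (auto simp: restart_def C)
next
  case (Seq P Q)
  then show ?case by simp
next
  case (PChoice P p Q)
  \<comment> \<open>For the set flag: both branches return \<open>C\<close>, and so must their
    mixture.\<close>
  have "ennreal p * c + ennreal (1 - p) * c = c" for c
    using PChoice.prems by (simp flip: distrib_right ennreal_plus)
  with PChoice show ?case
    by (auto simp: restart_def distrib_left mult.left_commute add_ac)
next
  case (While G P)
  let ?G = "\<lambda>\<sigma>. G \<sigma> \<and> \<not> var_true r \<sigma>"
  let ?W = "wp (flag_obs r (While G P)) (restart r C f v)"
  let ?A = "\<lambda>k \<sigma>. if G \<sigma> then owp 0 P k \<sigma> else f \<sigma>"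
  let ?D = "\<lambda>k \<sigma>. if G \<sigma> then owp 1 P k \<sigma> else v \<sigma>"
  note mono_steps = sup_continuous_owp_loop_step[THEN sup_continuous_mono]
  have IH: "wp (flag_obs r P) (restart r C a d) = restart r C (owp 0 P a) (owp 1 P d)" for a d
    using While by simp
  \<comment> \<open>One unrolling of the flagged loop unrolls both loops of \<open>owp\<close>;
    under a set flag both sides are \<open>C\<close>.\<close>
  have step: "(\<lambda>\<sigma>. if ?G \<sigma> then wp (flag_obs r P) (restart r C a d) \<sigma> else restart r C f v \<sigma>) =
      restart r C (?A a) (?D d)" for a d
    unfolding IH by (auto simp: restart_def)
  have W: "?W = (\<lambda>\<sigma>. if ?G \<sigma> then wp (flag_obs r P) ?W \<sigma> else restart r C f v \<sigma>)"
    unfolding flag_obs.simps by (rule wp_While_unfold)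
  show ?case
  proof (rule antisym)
    have "restart r C (?A (lfp ?A)) (?D (lfp ?D)) = restart r C (lfp ?A) (lfp ?D)"
      using lfp_unfold[OF mono_steps[of G 0 P f]] lfp_unfold[OF mono_steps[of G 1 P v]]
      by simp
    then have "?W \<le> restart r C (lfp ?A) (lfp ?D)"
      unfolding flag_obs.simps
      using fun_cong[OF step[of "lfp ?A" "lfp ?D"]] by (intro wp_While_le) simp
    then show "?W \<le> restart r C (owp 0 (While G P) f) (owp 1 (While G P) v)"
      by simp
    \<comment> \<open>\<open>?W\<close> is not known to have the form
      \<open>restart r C a d\<close>, so prefixed points of \<open>?A\<close> and \<open>?D\<close>
      cannot be read off it; their iterates are compared instead.\<close>
    have lower: "restart r C ((?A ^^ n) bot) ((?D ^^ n) bot) \<le> ?W" for n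
    proof (induction n)
      case 0
      \<comment> \<open>At \<open>bot\<close> the left side is \<open>C\<close>, not 0, under a set
        flag; there the loop exits at once with \<open>C\<close>.\<close>
      have "C \<sigma> \<le> ?W \<sigma>" if "\<sigma> r = Bool True" for \<sigma>
        using that by (subst W) (simp add: restart_def)
      then show ?case
        by (auto simp: restart_def le_fun_def bot_ennreal simp del: wp.simps flag_obs.simps)
    next
      case (Suc n)
      have "restart r C ((?A ^^ Suc n) bot) ((?D ^^ Suc n) bot) =
        (\<lambda>\<sigma>. if ?G \<sigma> then wp (flag_obs r P) (restart r C ((?A ^^ n) bot) ((?D ^^ n) bot)) \<sigma>
           else restart r C f v \<sigma>)"
        unfolding step by simp
      also have "\<dots> \<le> (\<lambda>\<sigma>. if ?G \<sigma> then wp (flag_obs r P) ?W \<sigma> else restart r C f v \<sigma>)"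
        using monoD[OF mono_loop_step Suc] .
      also have "\<dots> = ?W" using W by (rule sym)
      finally show ?case .
    qed
    show "restart r C (owp 0 (While G P) f) (owp 1 (While G P) v) \<le> ?W"
      unfolding owp.simps sup_continuous_lfp[OF sup_continuous_owp_loop_step]
      by (intro restart_SUP_le mono_funpow mono_steps lower)
  qed
qed (auto simp: restart_def C fun_eq_iff)

section \<open>Simultaneous assignment\<close>

lemma upd_list_nth:
  assumes "distinct xs" "length vs = length xs" "i < length xs"
  shows "upd_list \<sigma> xs vs (xs ! i) = vs ! i"
proof -
  have "map_of (zip xs vs) (xs ! i) = Some (vs ! i)"
    using assms by (subst map_of_eq_Some_iff) (auto simp: set_zip)
  then show ?thesis by (simp add: upd_list_def)
qed

lemma upd_list_other:
  assumes "y \<notin> set xs"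
  shows "upd_list \<sigma> xs vs y = \<sigma> y"
proof -
  have "map_of (zip xs vs) y = None"
    using assms by (auto simp: map_of_eq_None_iff dest: set_zip_leftD)
  then show ?thesis by (simp add: upd_list_def)
qed

lemma upd_list_cong:
  assumes "length vs = length xs" "\<And>y. y \<notin> set xs \<Longrightarrow> \<sigma> y = \<tau> y"
  shows "upd_list \<sigma> xs vs = upd_list \<tau> xs vs"
proof
  fix y
  show "upd_list \<sigma> xs vs y = upd_list \<tau> xs vs y"
  proof (cases "y \<in> set xs")
    case True
    then have "y \<in> dom (map_of (zip xs vs))"
      using assms(1) by simp
    then show ?thesis by (auto simp: upd_list_def)
  next
    case False
    then show ?thesis using assms(2) by (simp add: upd_list_other)
  qed
qed

section \<open>The equation \<open>c = a + c * q\<close> in \<open>ennreal\<close>\<close>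

text \<open>Split \<open>c\<close> as \<open>c * q + c * (1 - q)\<close> and cancel the finite
  \<open>c * q\<close>. For \<open>q > 0\<close> also \<open>c = top\<close> solves the
  equation.\<close>

lemma ennreal_geometric_eq:
  fixes a c q :: ennreal
  assumes "q \<le> 1" "1 - q \<noteq> 0" "c = a + c * q" "c < top"
  shows "c = a / (1 - q)"
proof -
  have "q + (1 - q) = 1"
    using diff_add_cancel_ennreal[OF assms(1)] by (simp only: add.commute)
  then have "c * q + c * (1 - q) = c"
    by (metis distrib_left mult.right_neutral)
  then have "c * q + c * (1 - q) = c * q + a"
    using assms(3) by (simp add: add.commute)
  moreover have "c * q < top"
    using assms(1,4) by (auto simp: ennreal_mult_less_top le_less_trans)
  ultimately have "c * (1 - q) = a"
    by (auto simp: ennreal_add_left_cancel)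
  moreover have "1 - q < top"
    by (simp add: less_top[symmetric])
  ultimately show ?thesis
    using assms(2) by (metis ennreal_mult_divide_eq less_top mult.commute)
qed

text \<open>Covers \<open>q = 1\<close> too, since a prefixed point is an inequality at all states,
  even where the quotient is undefined.\<close>

lemma ennreal_geometric_le:
  fixes a q :: ennreal
  assumes "q \<le> 1"
  shows "a + a / (1 - q) * q \<le> a / (1 - q)"
proof (cases "1 - q = 0 \<or> a = top")
  \<comment> \<open>Division by 0 yields 0 for \<open>a = 0\<close> and \<open>top\<close>
    otherwise.\<close>
  case True
  have "top / (1 - q) = top"
    by (simp add: ennreal_top_divide less_top[symmetric])
  with True show ?thesis by (cases "a = 0") auto
next
  case False
  have "a = a / (1 - q) * (1 - q)"
    using False by (simp add: ennreal_divide_times ennreal_divide_self less_top[symmetric])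
  then have "a + a / (1 - q) * q = a / (1 - q) * ((1 - q) + q)"
    by (metis distrib_left)
  also have "\<dots> = a / (1 - q)"
    using assms by (simp add: diff_add_cancel_ennreal)
  finally show ?thesis by simp
qed

section \<open>Solving the rerun loop\<close>

theorem mainTheorem4:
  fixes P :: "('v, 'a) cpgcl"
    and xs ss :: "'v list" and rerun :: 'v
    and f :: "('v, 'a) expectation"
    and \<sigma> :: "('v, 'a) state"
  assumes "cpgcl_over (set xs) P"
    and "length ss = length xs"
    and "distinct (xs @ ss @ [rerun])"
    and "depends_only (set xs) f"
    and "cwp2 P f \<sigma> \<noteq> 0"
  shows "cwp_cond P f \<sigma> = wp (rerun_prog xs ss rerun P) f \<sigma>"
proof -
  let ?V = "set xs"
  \<comment> \<open>the state in which an iteration of the rerun loop starts \<open>P'\<close>\<close>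
  define K :: "('v, 'a) state \<Rightarrow> ('v, 'a) state"
    where "K \<tau> = (upd_list \<tau> xs (map \<tau> ss))(rerun := Bool False)" for \<tau>
  define body :: "('v, 'a) pgcl" where
    "body = PSeq (copy_vars xs ss) (PSeq (PAssign rerun (\<lambda>_. Bool False)) (flag_obs rerun P))"
  define W where "W = wp (PWhile (var_true rerun) body) f"
  define A where "A = owp 0 P f"
  define D where "D = owp 1 P (\<lambda>_. 0)"
  have body: "wp body h \<tau> = wp (flag_obs rerun P) h (K \<tau>)" for h \<tau>
    by (simp add: body_def copy_vars_def K_def comp_def)
  \<comment> \<open>\<open>K\<close> overwrites the program variables and the flag, and the copies
    it reads are disjoint from them; so functions of \<open>K \<tau>\<close> are admissible restart
    values.\<close>
  have K_upd: "K (\<tau>(x := w)) = K \<tau>" if "x \<in> insert rerun ?V" for \<tau> x w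
  proof
    fix y
    have "x \<notin> set ss" using that assms(3) by auto
    then have ss_eq: "map (\<tau>(x := w)) ss = map \<tau> ss" by auto
    have "upd_list (\<tau>(x := w)) xs (map \<tau> ss) y = upd_list \<tau> xs (map \<tau> ss) y"
      if "y \<noteq> rerun"
    proof (cases "x \<in> ?V")
      case True
      then show ?thesis
        using assms(2) by (intro fun_cong[OF upd_list_cong]) auto
    next
      case False
      with \<open>x \<in> insert rerun ?V\<close> that show ?thesis by (auto simp: upd_list_def split: option.split)
    qed
    then show "K (\<tau>(x := w)) y = K \<tau> y"
      by (cases "y = rerun") (simp_all only: K_def ss_eq fun_upd_apply if_True if_False simp_thms)
  qed
  have K_rerun: "K \<tau> rerun \<noteq> Bool True" for \<tau>
    by (simp add: K_def)
  have KK: "K (K \<tau>) = K \<tau>" for \<tau>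
  proof -
    have "x \<notin> ?V \<and> x \<noteq> rerun" if "x \<in> set ss" for x
      using that assms(3) by auto
    then have ss_eq: "map (K \<tau>) ss = map \<tau> ss"
      by (simp add: K_def upd_list_other)
    have "upd_list (K \<tau>) xs (map \<tau> ss) = upd_list (\<tau>(rerun := Bool False)) xs (map \<tau> ss)"
      using assms(2) by (intro upd_list_cong) (auto simp: K_def upd_list_other)
    then have "K (K \<tau>) = (upd_list (\<tau>(rerun := Bool False)) xs (map \<tau> ss))(rerun := Bool False)"
      by (simp only: K_def[of "K \<tau>"] ss_eq)
    also have "\<dots> = K \<tau>"
      by (rule ext) (simp add: K_def upd_list_def split: option.split)
    finally show ?thesis .
  qed
  \<comment> \<open>With \<open>v = 0\<close>, \<open>restart\<close> gives \<open>C\<close> under a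
    set flag and \<open>f\<close> otherwise, as the rerun loop does. \<open>K\<close> clears the
    flag, so \<open>flag_obs rerun P\<close> starts in the affine case.\<close>
  have body_restart: "wp body (restart rerun C f (\<lambda>_. 0)) \<tau> = A (K \<tau>) + C (K \<tau>) * D (K \<tau>)"
    if "\<And>\<tau> x w. x \<in> insert rerun ?V \<Longrightarrow> C (\<tau>(x := w)) = C \<tau>" for C \<tau>
    unfolding body
    using wp_flag_obs_restart[OF assms(1) _ that, where f = f and v = "\<lambda>_. 0"] assms(3) K_rerun
    by (simp add: restart_def A_def D_def)
  have D1: "D \<tau> \<le> 1" for \<tau>
    unfolding D_def by (rule owp_le_1[OF _ assms(1)]) auto

  \<comment> \<open>Composing with \<open>K\<close> frees \<open>C\<close> from the program
    variables and the flag; by idempotence of \<open>K\<close> it is still the loop's value wherever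
    the flag is set.\<close>
  define C where "C \<tau> = wp body W (K \<tau>)" for \<tau>
  have C_upd: "C (\<tau>(x := w)) = C \<tau>" if "x \<in> insert rerun ?V" for \<tau> x w
    using K_upd[OF that] by (simp add: C_def)
  have W: "W = restart rerun C f (\<lambda>_. 0)"
    unfolding W_def by (subst wp_While_unfold)
      (auto simp: restart_def fun_eq_iff C_def body KK W_def)
  have C_eq: "C \<tau> = A (K \<tau>) + C \<tau> * D (K \<tau>)" for \<tau>
    using body_restart[of C "K \<tau>", OF C_upd] by (simp only: C_def KK flip: W)
  define Q where "Q \<tau> = A (K \<tau>) / (1 - D (K \<tau>))" for \<tau>
  have Q_upd: "Q (\<tau>(x := w)) = Q \<tau>" if "x \<in> insert rerun ?V" for \<tau> x w
    using K_upd[OF that] by (simp add: Q_def)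
  have "W \<le> restart rerun Q f (\<lambda>_. 0)"
    unfolding W_def
  proof (rule wp_While_le)
    fix \<tau>
    have "wp body (restart rerun Q f (\<lambda>_. 0)) \<tau> = A (K \<tau>) + Q (K \<tau>) * D (K \<tau>)"
      by (rule body_restart[OF Q_upd])
    also have "\<dots> \<le> Q \<tau>"
      unfolding Q_def KK by (rule ennreal_geometric_le[OF D1])
    finally have "wp body (restart rerun Q f (\<lambda>_. 0)) \<tau> \<le> Q \<tau>" .
    then show "(if var_true rerun \<tau> then wp body (restart rerun Q f (\<lambda>_. 0)) \<tau> else f \<tau>)
        \<le> restart rerun Q f (\<lambda>_. 0) \<tau>"
      by (simp add: restart_def)
  qed
  then have C_le: "C \<tau> \<le> Q \<tau>" if "\<tau> rerun = Bool True" for \<tau>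
    using that by (auto simp: W restart_def le_fun_def dest!: spec[of _ \<tau>])

  \<comment> \<open>The state in which the loop is entered; restoring from it recovers the program
    variables of \<open>\<sigma>\<close>.\<close>
  define \<rho> where "\<rho> = (upd_list \<sigma> ss (map \<sigma> xs))(rerun := Bool True)"
  have K_\<rho>: "K \<rho> x = \<sigma> x" if x: "x \<in> ?V" for x
  proof -
    obtain i where i: "x = xs ! i" "i < length xs"
      using x by (auto simp: in_set_conv_nth)
    have "ss ! i \<noteq> rerun" "x \<noteq> rerun"
      using x i assms(2,3) by auto
    then show ?thesis
      using i assms(2,3) by (simp add: K_def \<rho>_def upd_list_nth)
  qed
  have "depends_only ?V A" "depends_only ?V D"
    unfolding A_def D_def using assms(1,4)
    by (auto intro!: depends_only_owp) (simp add: depends_only_def)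
  then have AD: "A (K \<rho>) = A \<sigma>" "D (K \<rho>) = D \<sigma>"
    using K_\<rho> by (auto simp: depends_only_def)
  have "1 - D \<sigma> \<noteq> 0"
    using assms(5) by (simp add: cwp12_eq_owp[OF assms(1)] D_def)
  \<comment> \<open>An infinite \<open>C \<rho>\<close> forces \<open>Q \<rho> = top\<close> by the
    upper bound; a finite one is determined by \<open>C_eq\<close>.\<close>
  have "C \<rho> = Q \<rho>"
  proof (cases "C \<rho> = top")
    case True
    then show ?thesis using C_le[of \<rho>] by (simp add: \<rho>_def top_unique)
  next
    case False
    then show ?thesis
      using ennreal_geometric_eq[OF D1 _ C_eq, of \<rho>] AD \<open>1 - D \<sigma> \<noteq> 0\<close>
      by (simp add: Q_def less_top)
  qed
  moreover have "wp (rerun_prog xs ss rerun P) f \<sigma> = W \<rho>"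
    by (simp add: rerun_prog_def copy_vars_def \<rho>_def W_def body_def comp_def)
  moreover have "cwp_cond P f \<sigma> = Q \<rho>"
    unfolding Q_def AD by (simp add: cwp_cond_def cwp12_eq_owp[OF assms(1)] A_def D_def)
  ultimately show ?thesis
    by (simp add: W restart_def \<rho>_def)
qed

end
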